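(* Let $G_i=(V_i,E_i)$, $i=1,\dots,n$, be disjoint connected undirected graphs with given bridge nodes $l_i\in V_i$. Among all composite graphs $G$ formed from $G_1,\dots,G_n$ whose backbone graph $B$ is a tree on $\{l_1,\dots,l_n\}$, the coherence $H_C(G)$ is minimized when $B$ is a star graph whose center is a bridge node $l_c\in V_c$ with $c\in\arg\max_i|V_i|$.
   Context: Composite graph: given disjoint connected undirected graphs $G_i=(V_i,E_i)$, $i=1,\dots,n$, one node $l_i\in V_i$ (the bridge node of $G_i$) is chosen in each. The backbone graph $B=(V_B,E_B)$ is a connected undirected graph on $V_B=\{l_1,\dots,l_n\}$. The composite graph is $G=(V,E)$ with $V=V_1\cup\dots\cup V_n$ and $E=E_1\cup\dots\cup E_n\cup E_B$. Coherence: for a connected graph $G$ with $N$ nodes and (unweighted) Laplacian $L$, consider the noisy consensus dynamics $\dot x=-Lx+\nu$, with $\nu$ a zero-mean, unit-variance white noise. The network coherence is $H_C(G)=\lim_{t\to\infty}\sum_{j=1}^N\mathrm{var}\big(x_j-\frac1N\sum_{k=1}^Nx_k\big)$, which equals $\frac12\mathrm{tr}(L^\dagger)$, where $L^\dagger$ is the Moore–Penrose pseudo-inverse of $L$ (this known equality may be taken as the definition). Smaller coherence is better; "optimal" means minimizing $H_C(G)$. *)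

theory Defs
  imports
    "HOL-Analysis.Analysis"
    "Graph_Theory.Digraph_Component"
begin

text \<open>
  A finite simple undirected graph is a \<^locale>\<open>pair_graph\<close>: a finite, loop-free, symmetric
  digraph whose arcs are pairs of vertices, so that an undirected edge is a pair of opposite arcs.
  The qualified name \<open>Digraph_Component.connected\<close> avoids the topological notion of the same name;
  it includes that the vertex set is nonempty.

  The library's predicate \<open>tree\<close> is not used, because it counts a walk \<open>u, v, u\<close> as a cycle and is
  therefore false for every symmetric digraph with an edge. The cycles of an undirected graph are
  the cycles of length at least three.
\<close>

definition undirected_tree :: "'v pair_pre_digraph \<Rightarrow> bool" where
  "undirected_tree B \<longleftrightarrow>
     pair_graph B \<and> Digraph_Component.connected (with_proj B) \<and>
     \<not> (\<exists>p. pre_digraph.cycle (with_proj B) p \<and> 3 \<le> length p)"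

definition star_graph :: "'v set \<Rightarrow> 'v \<Rightarrow> 'v pair_pre_digraph" where
  "star_graph S z =
     \<lparr> pverts = S, parcs = {z} \<times> (S - {z}) \<union> (S - {z}) \<times> {z} \<rparr>"

definition composite_graph ::
    "nat \<Rightarrow> (nat \<Rightarrow> 'v pair_pre_digraph) \<Rightarrow> 'v pair_pre_digraph \<Rightarrow> 'v pair_pre_digraph" where
  "composite_graph n G B =
     \<lparr> pverts = (\<Union>i\<in>{1..n}. pverts (G i)),
       parcs = (\<Union>i\<in>{1..n}. parcs (G i)) \<union> parcs B \<rparr>"

text \<open>
  Matrices are indexed by the whole finite vertex type. The rows and columns of elements
  outside \<open>pverts G\<close> are zero, so this is the Laplacian of \<open>G\<close> bordered by a zero block. The
  pseudo-inverse of a matrix bordered in this way is its pseudo-inverse bordered by a zero block,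
  so the trace of the pseudo-inverse does not depend on the surplus elements.
\<close>

definition laplacian :: "'v::finite pair_pre_digraph \<Rightarrow> real^'v^'v" where
  "laplacian G =
     (\<chi> u v. if u = v then real (out_degree (with_proj G) u)
             else if (u, v) \<in> parcs G then -1 else 0)"

definition is_pseudo_inverse :: "real^'m^'n \<Rightarrow> real^'n^'m \<Rightarrow> bool" where
  "is_pseudo_inverse A X \<longleftrightarrow>
     A ** X ** A = A \<and> X ** A ** X = X \<and>
     transpose (A ** X) = A ** X \<and> transpose (X ** A) = X ** A"

definition pseudo_inverse :: "real^'m^'n \<Rightarrow> real^'n^'m" where
  "pseudo_inverse A = (THE X. is_pseudo_inverse A X)"

lemma is_pseudo_inverse_unique:
  assumes X: "is_pseudo_inverse A X" and Y: "is_pseudo_inverse A Y"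
  shows "X = Y"
proof -
  note x = X[unfolded is_pseudo_inverse_def] and y = Y[unfolded is_pseudo_inverse_def]
  have "A ** X = (A ** Y) ** (A ** X)" using y by (metis matrix_mul_assoc)
  also have "\<dots> = transpose ((A ** X) ** (A ** Y))" using x y by (metis matrix_transpose_mul)
  also have "\<dots> = A ** Y" using x y by (metis matrix_mul_assoc)
  finally have l: "A ** X = A ** Y" .
  have "X ** A = (X ** A) ** (Y ** A)" using y by (metis matrix_mul_assoc)
  also have "\<dots> = transpose ((Y ** A) ** (X ** A))" using x y by (metis matrix_transpose_mul)
  also have "\<dots> = Y ** A" using x y by (metis matrix_mul_assoc)
  finally have r: "X ** A = Y ** A" .
  show ?thesis using l r x y by (metis matrix_mul_assoc)
qed

text \<open>
  For a connected graph this is the limiting total variance, about the mean, of the noisy consensus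
  dynamics \<open>x' = - L x + \<nu>\<close> with unit-variance white noise \<open>\<nu>\<close>.
\<close>

definition coherence :: "'v::finite pair_pre_digraph \<Rightarrow> real" where
  "coherence G = trace (pseudo_inverse (laplacian G)) / 2"

end

theory Submission
  imports Defs
begin

text \<open>
  Let \<open>N\<close> be the total number of nodes and root the backbone tree at the bridge node \<open>l c\<close> of a
  largest part. Removing the edge from a bridge node \<open>k \<noteq> l c\<close> to its parent splits the composite
  graph into two pieces; let \<open>S k\<close> be the number of nodes in the piece below \<open>k\<close>. The trace of
  the pseudo-inverse is, up to the factor \<open>N\<close>, the sum of all effective resistances, and each
  backbone edge lies between exactly \<open>S k * (N - S k)\<close> pairs of nodes. So
  twice the coherence is a constant that depends on the parts alone plus the sum over \<open>k \<noteq> l c\<close> of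
  \<open>S k * (N - S k) / N\<close>.

  If \<open>m k\<close> is the size of the part of \<open>k\<close>, then \<open>m k \<le> S k\<close>, and \<open>S k \<le> N - m (l c) \<le> N - m k\<close>,
  because the piece below \<open>k\<close> misses the largest part. The function \<open>s \<mapsto> s * (N - s)\<close> is concave and
  symmetric about \<open>N / 2\<close>, hence \<open>m k * (N - m k) \<le> S k * (N - S k)\<close>. In the star with center
  \<open>l c\<close> every \<open>S k\<close> equals \<open>m k\<close>, so the star is optimal, edge by edge.

  The formula for the coherence is proved with potentials instead of resistances. If
  \<open>L x\<^sub>v = e\<^sub>v - e\<^sub>r\<close> for all nodes \<open>v\<close> and one fixed node \<open>r\<close>, then projecting the matrix with the
  columns \<open>x\<^sub>v\<close> to the vectors of mean zero gives the pseudo-inverse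
  (\<open>coherence_of_grounded_potentials\<close>). For a composite graph such an \<open>x\<^sub>v\<close> is the sum of a
  potential of the parts that vanishes at every bridge node, and of the indicators of the pieces
  below those \<open>k\<close> that lie on the way from \<open>v\<close> to the root (\<open>coherence_rooted_tree\<close>).
\<close>

section \<open>Laplacians and their pseudo-inverses\<close>

text \<open>
  A right inverse of \<open>L\<close> on the range of \<open>P\<close> need be neither symmetric nor unique. Compressing it by
  the projection \<open>P\<close> repairs both: \<open>P X\<^sup>T L X P\<close> is symmetric, and it collapses to \<open>P X P\<close>.
\<close>

lemma pseudo_inverse_between_projections:
  fixes L X P :: "real^'n^'n"
  assumes L: "transpose L = L" and P: "transpose P = P" "P ** P = P"
    and PL: "P ** L = L" and LXP: "L ** X ** P = P"
  shows "pseudo_inverse L = P ** X ** P"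
proof -
  define Z where "Z = P ** X ** P"
  have LP: "L ** P = L" using arg_cong[OF PL, of transpose] L P(1) by (simp add: matrix_transpose_mul)
  have PXL: "P ** transpose X ** L = P"
    using arg_cong[OF LXP, of transpose] L P(1) by (simp add: matrix_transpose_mul matrix_mul_assoc)
  have "Z = (P ** transpose X ** L) ** X ** P" by (simp add: PXL Z_def)
  also have "\<dots> = P ** transpose X ** (L ** X ** P)" by (simp add: matrix_mul_assoc)
  also have "\<dots> = transpose Z" by (simp add: LXP Z_def P(1) matrix_transpose_mul matrix_mul_assoc)
  finally have Z: "transpose Z = Z" by simp
  have LZ: "L ** Z = P" by (simp add: Z_def matrix_mul_assoc LP LXP)
  have ZL: "Z ** L = P" using arg_cong[OF LZ, of transpose] L P(1) Z by (simp add: matrix_transpose_mul)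
  have "is_pseudo_inverse L Z"
    unfolding is_pseudo_inverse_def LZ ZL using P PL by (simp add: Z_def matrix_mul_assoc)
  then show ?thesis
    unfolding pseudo_inverse_def Z_def[symmetric] by (blast intro: is_pseudo_inverse_unique)
qed

text \<open>
  The Laplacian of a graph as an operator that depends on the set of arcs alone. In this form it
  is additive in the arc set, so the parts and the backbone can be treated separately.
\<close>

definition arc_laplacian :: "('v::finite \<times> 'v) set \<Rightarrow> real^'v \<Rightarrow> real^'v" where
  "arc_laplacian E x = (\<chi> u. \<Sum>w | (u, w) \<in> E. x $ u - x $ w)"

lemma arc_laplacian_nth: "arc_laplacian E x $ u = (\<Sum>w | (u, w) \<in> E. x $ u - x $ w)"
  by (simp add: arc_laplacian_def)

lemma laplacian_mult_eq_arc_laplacian: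
  assumes "irrefl (parcs H)"
  shows "laplacian H *v x = arc_laplacian (parcs H) x"
proof (simp add: vec_eq_iff, intro allI)
  fix u
  have out: "out_arcs (with_proj H) u = Pair u ` {w. (u, w) \<in> parcs H}"
    by (auto simp: out_arcs_def)
  have deg: "out_degree (with_proj H) u = card {w. (u, w) \<in> parcs H}"
    unfolding out_degree_def out by (simp add: card_image inj_on_def)
  have u: "(u, u) \<notin> parcs H" using assms by (auto simp: irrefl_def)
  have "(laplacian H *v x) $ u =
      (\<Sum>w\<in>UNIV. (if w = u then real (out_degree (with_proj H) u) * x $ u else 0)
        - (if (u, w) \<in> parcs H then x $ w else 0))"
    unfolding matrix_vector_mult_def laplacian_def using u by (auto intro!: sum.cong)
  also have "\<dots> = real (out_degree (with_proj H) u) * x $ u - (\<Sum>w | (u, w) \<in> parcs H. x $ w)"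
    by (simp add: sum_subtractf sum.If_cases)
  also have "\<dots> = arc_laplacian (parcs H) x $ u"
    by (simp add: deg arc_laplacian_nth sum_subtractf)
  finally show "(laplacian H *v x) $ u = arc_laplacian (parcs H) x $ u" .
qed

lemma linear_arc_laplacian: "linear (arc_laplacian E)"
  by (rule linearI)
    (auto simp: vec_eq_iff arc_laplacian_nth sum_distrib_left algebra_simps sum.distrib sum_subtractf)

lemma arc_laplacian_Un: "E \<inter> F = {} \<Longrightarrow> arc_laplacian (E \<union> F) x = arc_laplacian E x + arc_laplacian F x"
proof -
  assume "E \<inter> F = {}"
  then have "{w. (u, w) \<in> E \<union> F} = {w. (u, w) \<in> E} \<union> {w. (u, w) \<in> F}"
    "{w. (u, w) \<in> E} \<inter> {w. (u, w) \<in> F} = {}" for u by auto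
  then show ?thesis by (simp add: vec_eq_iff arc_laplacian_nth sum.union_disjoint)
qed

lemma arc_laplacian_eq_0: "(\<And>u w. (u, w) \<in> E \<Longrightarrow> x $ u = x $ w) \<Longrightarrow> arc_laplacian E x = 0"
  by (simp add: vec_eq_iff arc_laplacian_nth)

text \<open>
  This is the energy form of the graph. Its symmetry makes the Laplacian self-adjoint, and its
  positivity forces a function in the kernel to be constant on connected components.
\<close>

lemma dirichlet_form:
  assumes "sym E"
  shows "arc_laplacian E x \<bullet> y = (\<Sum>(u, w)\<in>E. (x $ u - x $ w) * (y $ u - y $ w)) / 2"
proof -
  have *: "arc_laplacian E x \<bullet> y = (\<Sum>(u, w)\<in>E. (x $ u - x $ w) * y $ u)"
  proof -
    have E: "E = Sigma UNIV (\<lambda>u. {w. (u, w) \<in> E})" by auto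
    show ?thesis
      by (subst (2) E, subst sum.Sigma[symmetric])
        (auto simp: inner_vec_def arc_laplacian_nth sum_distrib_right)
  qed
  \<comment> \<open>Reverse every arc and average the two expressions.\<close>
  also have "\<dots> = (\<Sum>(u, w)\<in>E. (x $ w - x $ u) * y $ w)"
    by (rule sum.reindex_bij_witness[of _ prod.swap prod.swap])
      (use assms in \<open>auto dest: symD\<close>)
  finally have "2 * (arc_laplacian E x \<bullet> y) =
      (\<Sum>(u, w)\<in>E. (x $ u - x $ w) * y $ u) + (\<Sum>(u, w)\<in>E. (x $ w - x $ u) * y $ w)"
    using * by simp
  also have "\<dots> = (\<Sum>(u, w)\<in>E. (x $ u - x $ w) * (y $ u - y $ w))"
    by (simp add: sum.distrib[symmetric] case_prod_beta algebra_simps)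
  finally show ?thesis by simp
qed

lemma arc_laplacian_self_adjoint: "sym E \<Longrightarrow> arc_laplacian E x \<bullet> y = x \<bullet> arc_laplacian E y"
  by (subst inner_commute[of x]) (simp add: dirichlet_form mult.commute)

lemma arc_laplacian_eq_0D:
  assumes "sym E" "arc_laplacian E x = 0" "(u, w) \<in> E\<^sup>*"
  shows "x $ u = x $ w"
proof -
  have "(\<Sum>(u, w)\<in>E. (x $ u - x $ w)^2) = 0"
    using dirichlet_form[OF assms(1), of x x] assms(2) by (simp add: power2_eq_square)
  then have arc: "x $ a = x $ b" if "(a, b) \<in> E" for a b
    using that by (subst (asm) sum_nonneg_eq_0_iff) auto
  show ?thesis using assms(3) by (induct rule: rtrancl_induct) (simp_all add: arc)
qed

text \<open>
  The range of a self-adjoint operator is the orthogonal complement of its kernel. This gives the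
  solvability of \<open>L x = b\<close>.
\<close>

lemma range_self_adjoint:
  fixes f :: "'a::euclidean_space \<Rightarrow> 'a"
  assumes "linear f" and adj: "\<And>x y. f x \<bullet> y = x \<bullet> f y"
    and ker: "\<And>x. f x = 0 \<Longrightarrow> x \<bullet> b = 0"
  shows "b \<in> range f"
proof -
  have "adjoint f = f" by (rule adjoint_unique) (simp add: adj)
  then have "f -` {0} = (range f)\<^sup>\<bottom>" using ker_orthogonal_comp_adjoint[OF \<open>linear f\<close>] by simp
  moreover have "b \<in> (f -` {0})\<^sup>\<bottom>" using ker by (auto simp: orthogonal_comp_def orthogonal_def)
  ultimately show ?thesis
    using orthogonal_comp_self[OF linear_subspace_image[OF \<open>linear f\<close> subspace_UNIV]] by simp
qed

text \<open>
  The orthogonal projection to the vectors that are supported on \<open>V\<close> and have mean zero there. For a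
  connected graph on \<open>V\<close> this is the projection to the range of the Laplacian.
\<close>

definition centering :: "'v::finite set \<Rightarrow> real^'v^'v" where
  "centering V = (\<chi> u w. if u \<in> V \<and> w \<in> V then (if u = w then 1 else 0) - 1 / card V else 0)"

lemma centering_mult_nth:
  "(centering V *v z) $ u = (if u \<in> V then z $ u - (\<Sum>w\<in>V. z $ w) / card V else 0)"
proof -
  have "(centering V *v z) $ u =
      (\<Sum>w\<in>UNIV. if w \<in> V then (if u \<in> V then (if u = w then z $ w else 0) - z $ w / card V else 0) else 0)"
    unfolding matrix_vector_mult_def centering_def by (auto intro!: sum.cong simp: algebra_simps)
  also have "\<dots> = (if u \<in> V then z $ u - (\<Sum>w\<in>V. z $ w) / card V else 0)"
    by (subst sum.If_cases) (auto simp: sum_subtractf sum_divide_distrib)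
  finally show ?thesis .
qed

lemma centering_mult_id:
  assumes "\<And>u. u \<notin> V \<Longrightarrow> z $ u = 0" "(\<Sum>w\<in>V. z $ w) = 0"
  shows "centering V *v z = z"
  using assms by (auto simp: vec_eq_iff centering_mult_nth)

lemma sum_centering_mult: "(\<Sum>u\<in>V. (centering V *v z) $ u) = 0"
  by (cases "V = {}") (simp_all add: centering_mult_nth sum_subtractf)

lemma trace_centering_mult:
  "trace (centering V ** X) = (\<Sum>v\<in>V. column v X $ v - (\<Sum>w\<in>V. column v X $ w) / card V)"
proof -
  have "(centering V ** X) $ v $ v = (centering V *v column v X) $ v" for v
    by (simp add: matrix_matrix_mult_def matrix_vector_mult_def column_def)
  then show ?thesis by (simp add: trace_def centering_mult_nth sum.If_cases)
qed

text \<open>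
  \<open>x v\<close> is the potential when a unit current enters at \<open>v\<close> and leaves at \<open>r\<close>. The matrix \<open>X\<close> of
  these columns satisfies \<open>L X z = z\<close> for every \<open>z\<close> of mean zero on \<open>V\<close>, because the currents leaving
  at \<open>r\<close> cancel. So the pseudo-inverse is \<open>P X P\<close>, and its trace is that of \<open>P X\<close>. The potentials may be
  normalized in any way, since \<open>P\<close> removes additive constants.
\<close>

lemma coherence_of_grounded_potentials:
  fixes x :: "'v::finite \<Rightarrow> real^'v"
  assumes E: "parcs H \<subseteq> V \<times> V" "sym (parcs H)" "irrefl (parcs H)"
    and x: "\<And>v. v \<in> V \<Longrightarrow> arc_laplacian (parcs H) (x v) = axis v 1 - axis r 1"
  shows "coherence H = (\<Sum>v\<in>V. x v $ v - (\<Sum>w\<in>V. x v $ w) / card V) / 2"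
proof -
  define X where "X = (\<chi> u v. x v $ u)"
  have colX: "column v X = x v" for v by (simp add: X_def column_def vec_eq_iff)
  note L = laplacian_mult_eq_arc_laplacian[OF E(3)]
  have sL: "transpose (laplacian H) = laplacian H"
    by (auto simp: vec_eq_iff transpose_def laplacian_def dest: symD[OF E(2)])
  have sP: "transpose (centering V) = centering V"
    by (auto simp: vec_eq_iff transpose_def centering_def)
  have PP: "centering V ** centering V = centering V"
    by (simp add: matrix_eq matrix_vector_mul_assoc[symmetric])
      (intro allI centering_mult_id, simp_all add: sum_centering_mult, simp add: centering_mult_nth)
  have PL: "centering V ** laplacian H = laplacian H"
  proof (simp add: matrix_eq matrix_vector_mul_assoc[symmetric] L, intro allI centering_mult_id)
    fix z u assume "u \<notin> V"
    then have "{w. (u, w) \<in> parcs H} = {}" using E(1) by auto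
    then show "arc_laplacian (parcs H) z $ u = 0" by (simp add: arc_laplacian_nth)
  next
    fix z
    \<comment> \<open>The Laplacian maps into mean zero because it is self-adjoint and kills the indicator of \<open>V\<close>.\<close>
    define i :: "real^'v" where "i = (\<chi> u. of_bool (u \<in> V))"
    have "arc_laplacian (parcs H) i = 0" using E(1) by (intro arc_laplacian_eq_0) (auto simp: i_def)
    then have "arc_laplacian (parcs H) z \<bullet> i = 0" using arc_laplacian_self_adjoint[OF E(2)] by simp
    then show "(\<Sum>w\<in>V. arc_laplacian (parcs H) z $ w) = 0"
      by (simp add: i_def inner_vec_def of_bool_def if_distrib sum.If_cases cong: if_cong)
  qed
  have LXP: "laplacian H ** X ** centering V = centering V"
  proof (simp add: matrix_eq matrix_vector_mul_assoc[symmetric], intro allI)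
    fix z
    define w where "w = centering V *v z"
    have w0: "w $ v = 0" if "v \<notin> V" for v using that by (simp add: w_def centering_mult_nth)
    have ws: "(\<Sum>v\<in>V. w $ v) = 0" by (simp add: w_def sum_centering_mult)
    have "X *v w = (\<Sum>v\<in>UNIV. w $ v *\<^sub>R x v)"
      by (simp add: matrix_mult_sum colX scalar_mult_eq_scaleR)
    also have "\<dots> = (\<Sum>v\<in>V. w $ v *\<^sub>R x v)"
      by (rule sum.mono_neutral_right) (auto simp: w0)
    finally have "laplacian H *v (X *v w) = (\<Sum>v\<in>V. w $ v *\<^sub>R (axis v 1 - axis r 1))"
      by (simp add: L linear_sum[OF linear_arc_laplacian] linear_cmul[OF linear_arc_laplacian] x)
    also have "\<dots> = (\<Sum>v\<in>V. w $ v *\<^sub>R axis v 1) - (\<Sum>v\<in>V. w $ v) *\<^sub>R axis r 1"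
      by (simp add: scaleR_diff_right sum_subtractf scaleR_sum_left)
    also have "(\<Sum>v\<in>V. w $ v *\<^sub>R axis v 1) = w"
      by (auto simp: vec_eq_iff axis_def if_distrib w0 cong: if_cong)
    finally show "laplacian H *v (X *v (centering V *v z)) = centering V *v z"
      by (simp add: ws w_def[symmetric])
  qed
  have "trace (pseudo_inverse (laplacian H)) = trace (centering V ** X ** centering V)"
    by (simp add: pseudo_inverse_between_projections[OF sL sP PP PL LXP])
  also have "\<dots> = trace (centering V ** X)"
    by (subst trace_mul_sym) (simp add: matrix_mul_assoc PP)
  finally show ?thesis by (simp add: coherence_def trace_centering_mult colX)
qed

section \<open>Rooted trees\<close>

text \<open>
  A rooted tree is given by its parent map. Any function \<open>depth\<close> that decreases towards the root
  excludes cycles; it need not be the distance to the root.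
\<close>

locale rooted_tree =
  fixes S :: "'a set" and r :: 'a and par :: "'a \<Rightarrow> 'a" and depth :: "'a \<Rightarrow> nat"
  assumes root_in: "r \<in> S"
    and par_in: "k \<in> S - {r} \<Longrightarrow> par k \<in> S"
    and depth_par: "k \<in> S - {r} \<Longrightarrow> depth (par k) < depth k"
begin

definition up :: "'a rel" where "up = {(k, par k) | k. k \<in> S - {r}}"

definition subtree :: "'a \<Rightarrow> 'a set" where "subtree k = {j. (j, k) \<in> up\<^sup>*}"

lemma upI: "k \<in> S - {r} \<Longrightarrow> (k, par k) \<in> up"
  by (auto simp: up_def)

lemma subtree_self: "k \<in> subtree k"
  by (simp add: subtree_def)

lemma subtree_depth: "j \<in> subtree k \<Longrightarrow> j = k \<or> depth k < depth j"
  unfolding subtree_def mem_Collect_eq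
proof (induct rule: converse_rtrancl_induct)
  case (step j i)
  then have "depth i < depth j" using depth_par by (auto simp: up_def)
  then show ?case using step.hyps(3) by auto
qed simp

lemma par_notin_subtree: "k \<in> S - {r} \<Longrightarrow> par k \<notin> subtree k"
  using depth_par[of k] subtree_depth[of "par k" k] by force

lemma par_neq: "k \<in> S - {r} \<Longrightarrow> par k \<noteq> k"
  using depth_par[of k] by force

lemma subtree_step:
  assumes "j \<in> S - {r}"
  shows "j \<in> subtree k \<longleftrightarrow> j = k \<or> par j \<in> subtree k"
  unfolding subtree_def mem_Collect_eq
  by (subst rtrancl_eq_or_trancl, subst trancl_unfold_left)
    (use assms in \<open>auto simp: up_def relcomp_unfold\<close>)

lemma root_in_subtree: "r \<in> subtree k \<Longrightarrow> k = r"
  unfolding subtree_def mem_Collect_eq by (erule converse_rtranclE) (auto simp: up_def)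

lemma up_root: "k \<in> S \<Longrightarrow> (k, r) \<in> up\<^sup>*"
proof (induct "depth k" arbitrary: k rule: less_induct)
  case less
  show ?case
  proof (cases "k = r")
    case False
    then have "k \<in> S - {r}" using less.prems by simp
    then show ?thesis
      using less.hyps[OF depth_par par_in] upI by (meson converse_rtrancl_into_rtrancl)
  qed simp
qed

text \<open>
  The vertices \<open>k\<close> with \<open>j\<close> in their subtree are those on the way from \<open>j\<close> to the root, so the sum
  telescopes.
\<close>

lemma sum_edges_to_root:
  fixes f :: "'a \<Rightarrow> 'b::ab_group_add"
  assumes "finite S" "j \<in> S"
  shows "(\<Sum>k | k \<in> S - {r} \<and> j \<in> subtree k. f k - f (par k)) = f j - f r"
  using assms(2)
proof (induct "depth j" arbitrary: j rule: less_induct)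
  case less
  show ?case
  proof (cases "j = r")
    case True
    then have "{k. k \<in> S - {r} \<and> j \<in> subtree k} = {}" using root_in_subtree by auto
    then show ?thesis using True by (simp only: sum.empty) simp
  next
    case False
    then have j: "j \<in> S - {r}" using less.prems by simp
    have eq: "{k. k \<in> S - {r} \<and> j \<in> subtree k} = insert j {k. k \<in> S - {r} \<and> par j \<in> subtree k}"
      using j by (auto simp: subtree_step[OF j])
    have notin: "j \<notin> {k. k \<in> S - {r} \<and> par j \<in> subtree k}"
      using par_notin_subtree[OF j] by simp
    have fin: "finite {k. k \<in> S - {r} \<and> par j \<in> subtree k}"
      using \<open>finite S\<close> by simp
    have "(\<Sum>k | k \<in> S - {r} \<and> j \<in> subtree k. f k - f (par k)) =
        (f j - f (par j)) + (\<Sum>k | k \<in> S - {r} \<and> par j \<in> subtree k. f k - f (par k))"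
      unfolding eq by (rule sum.insert[OF fin notin])
    then show ?thesis using less.hyps[OF depth_par[OF j] par_in[OF j]] by simp
  qed
qed

text \<open>
  The edge from \<open>k\<close> to its parent is the only edge that leaves the subtree of \<open>k\<close>.
\<close>

lemma arc_crossing_subtree:
  assumes k: "k \<in> S - {r}" and e: "(u, w) \<in> up \<union> up\<inverse>"
  shows "of_bool (u \<in> subtree k) - of_bool (w \<in> subtree k) =
    (of_bool (u = k \<and> w = par k) - of_bool (u = par k \<and> w = k) :: real)"
proof -
  have one_way: "a \<in> subtree k \<and> b \<notin> subtree k \<longleftrightarrow> a = k \<and> b = par k"
    "\<not> (b \<in> subtree k \<and> a \<notin> subtree k)" "\<not> (a = par k \<and> b = k)"
    if "(a, b) \<in> up" for a b
  proof -
    have a: "a \<in> S - {r}" and b: "b = par a" using that by (auto simp: up_def)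
    show "a \<in> subtree k \<and> b \<notin> subtree k \<longleftrightarrow> a = k \<and> b = par k"
      using subtree_step[OF a, of k] subtree_self[of k] par_notin_subtree[OF k] b by auto
    show "\<not> (b \<in> subtree k \<and> a \<notin> subtree k)"
      using subtree_step[OF a, of k] b by simp
    show "\<not> (a = par k \<and> b = k)"
      using depth_par[OF a] depth_par[OF k] b by auto
  qed
  from e consider "(u, w) \<in> up" | "(w, u) \<in> up" by auto
  then show ?thesis
    by cases (use one_way[of u w] one_way[of w u] in \<open>auto simp: of_bool_def split: if_splits\<close>)
qed

end

text \<open>
  Seen by the tree, the indicator of a subtree is the potential of a unit current through the
  edge above its top vertex. These indicators are the building blocks for the inverse of the
  Laplacian of a tree.
\<close>

lemma arc_laplacian_indicator_subtree:
  fixes S :: "'v::finite set"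
  assumes "rooted_tree S r par depth" and k: "k \<in> S - {r}"
    and x: "\<And>u. u \<in> S \<Longrightarrow> x $ u = of_bool (u \<in> rooted_tree.subtree S r par k)"
  defines "T \<equiv> rooted_tree.up S r par \<union> (rooted_tree.up S r par)\<inverse>"
  shows "arc_laplacian T x = axis k 1 - axis (par k) 1"
proof -
  interpret rooted_tree S r par depth by fact
  have T: "T \<subseteq> S \<times> S" using par_in by (auto simp: T_def up_def)
  have kT: "(k, par k) \<in> T" "(par k, k) \<in> T" using upI[OF k] by (auto simp: T_def)
  have "arc_laplacian T x $ u = axis k 1 $ u - axis (par k) 1 $ u" for u
  proof -
    have "arc_laplacian T x $ u =
        (\<Sum>w | (u, w) \<in> T. of_bool (u = k \<and> w = par k) - of_bool (u = par k \<and> w = k))"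
      unfolding arc_laplacian_nth
    proof (rule sum.cong)
      fix w assume "w \<in> {w. (u, w) \<in> T}"
      then have uw: "(u, w) \<in> T" by simp
      then have "u \<in> S" "w \<in> S" using T by auto
      then show "x $ u - x $ w = of_bool (u = k \<and> w = par k) - of_bool (u = par k \<and> w = k)"
        using arc_crossing_subtree[OF k, of u w] uw by (simp add: x T_def)
    qed simp
    also have "\<dots> = (\<Sum>w\<in>{w. (u, w) \<in> T}. if w = par k then of_bool (u = k) else 0)
        - (\<Sum>w\<in>{w. (u, w) \<in> T}. if w = k then of_bool (u = par k) else 0)"
      by (subst sum_subtractf[symmetric]) (auto intro!: sum.cong)
    also have "\<dots> = axis k 1 $ u - axis (par k) 1 $ u"
      using kT by (auto simp: axis_def)
    finally show ?thesis .
  qed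
  then show ?thesis by (simp add: vec_eq_iff)
qed

section \<open>Undirected trees and stars\<close>

lemma connected_rtrancl:
  assumes "pair_graph G" "Digraph_Component.connected (with_proj G)" "u \<in> pverts G" "v \<in> pverts G"
  shows "(u, v) \<in> (parcs G)\<^sup>*"
proof -
  interpret pair_graph G by fact
  have "strongly_connected (with_proj G)"
    using symmetric_connected_imp_strongly_connected assms(2) sym_arcs by blast
  then have "u \<rightarrow>\<^sup>*\<^bsub>with_proj G\<^esub> v" using assms(3,4) by (auto simp: strongly_connected_def)
  then show ?thesis using reachable_rtranclI by force
qed

text \<open>
  A path between the ends of an edge that avoids the edge has at least two arcs. Closing it with
  the edge gives a cycle of length at least three.
\<close>

lemma undirected_tree_arc_is_bridge:
  assumes "undirected_tree B" and uv: "(u, v) \<in> parcs B"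
  shows "(u, v) \<notin> (parcs B - {(u, v), (v, u)})\<^sup>*"
proof
  assume reach: "(u, v) \<in> (parcs B - {(u, v), (v, u)})\<^sup>*"
  interpret pair_graph B using assms(1) by (simp add: undirected_tree_def)
  define B' where "B' = \<lparr>pverts = pverts B, parcs = parcs B - {(u, v), (v, u)}\<rparr>"
  interpret B': pair_wf_digraph B'
    by unfold_locales (auto simp: B'_def dest: in_arcsD1 in_arcsD2)
  have "u \<in> pverts B'" using uv by (simp add: B'_def in_arcsD1)
  then have "u \<rightarrow>\<^sup>*\<^bsub>with_proj B'\<^esub> v" using reach B'.reachable_conv' by (simp add: B'_def)
  then obtain p where p: "B'.apath u p v" using B'.reachable_apath by blast
  then have "set p \<subseteq> parcs B'" and cas: "pcas u p v" and dist: "distinct (pawalk_verts u p)"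
    by (auto simp: B'.apath_def B'.awalk_def)
  then have B'p: "set p \<subseteq> parcs B - {(u, v), (v, u)}" "pcas u p v" by (auto simp: B'_def)
  have "u \<noteq> v" using uv no_loops' by blast
  have len: "2 \<le> length p"
  proof (rule ccontr)
    assume "\<not> 2 \<le> length p"
    then consider "p = []" | a where "p = [a]" by (cases p; cases "tl p") auto
    then show False
    proof cases
      case 2
      then have "a = (u, v)" using B'p(2) by (cases a) auto
      then show False using 2 B'p(1) by simp
    qed (use B'p \<open>u \<noteq> v\<close> in auto)
  qed
  have vu: "(v, u) \<in> parcs B" using uv arcs_symmetric by blast
  have walk: "awalk u p v" using B'p uv by (auto simp: awalk_def in_arcsD1)
  then have closed: "awalk u (p @ [(v, u)]) u"
    using vu by (intro awalk_appendI) (auto simp: awalk_simps in_arcsD1 in_arcsD2)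
  have "tl (pawalk_verts u (p @ [(v, u)])) = tl (pawalk_verts u p) @ [u]"
    using awalk_verts_append[OF closed] walk len by (cases p) auto
  moreover have "pawalk_verts u p = u # tl (pawalk_verts u p)"
    using B'p len by (cases p) auto
  then have "distinct (tl (pawalk_verts u p) @ [u])" using dist by (metis distinct.simps(2) distinct1_rotate rotate1.simps(2))
  ultimately have "cycle (p @ [(v, u)])" using closed by (auto simp: cycle_def)
  moreover have "3 \<le> length (p @ [(v, u)])" using len by simp
  ultimately show False using assms(1) unfolding undirected_tree_def by blast
qed

text \<open>
  As the parent of a vertex take any neighbour that is closer to the root. The edges to parents
  already connect the ends of any further edge through the root, and this contradicts that
  the further edge is a bridge.
\<close>

lemma undirected_tree_rooted:
  assumes T: "undirected_tree B" and r: "r \<in> pverts B"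
  obtains par depth where "rooted_tree (pverts B) r par depth"
    "parcs B = rooted_tree.up (pverts B) r par \<union> (rooted_tree.up (pverts B) r par)\<inverse>"
proof -
  let ?R = "parcs B"
  interpret B: pair_graph B using T by (simp add: undirected_tree_def)
  define depth where "depth v = (LEAST m. (v, r) \<in> ?R ^^ m)" for v
  have step: "\<exists>w. (k, w) \<in> ?R \<and> depth w < depth k" if k: "k \<in> pverts B - {r}" for k
  proof -
    have "(k, r) \<in> ?R\<^sup>*"
      using T k r by (intro connected_rtrancl) (auto simp: undirected_tree_def)
    then obtain m where "(k, r) \<in> ?R ^^ m" using rtrancl_imp_relpow by blast
    then have kr: "(k, r) \<in> ?R ^^ depth k" unfolding depth_def by (rule LeastI)
    then obtain m' where m': "depth k = Suc m'" using k by (cases "depth k") auto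
    then obtain w where w: "(k, w) \<in> ?R" "(w, r) \<in> ?R ^^ m'"
      using kr by (metis relpow_Suc_D2)
    then have "depth w \<le> m'" unfolding depth_def by (intro Least_le)
    then show ?thesis using w m' by auto
  qed
  define par where "par k = (SOME w. (k, w) \<in> ?R \<and> depth w < depth k)" for k
  have par: "(k, par k) \<in> ?R" "depth (par k) < depth k" if "k \<in> pverts B - {r}" for k
    using someI_ex[OF step[OF that]] by (auto simp: par_def)
  interpret rooted_tree "pverts B" r par depth
    using r par by unfold_locales (auto dest: B.in_arcsD2)
  have sub: "up \<union> up\<inverse> \<subseteq> ?R" using par(1) B.arcs_symmetric by (auto simp: up_def)
  have "?R \<subseteq> up \<union> up\<inverse>"
  proof
    fix e assume e: "e \<in> ?R"
    obtain u v where uv: "e = (u, v)" by force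
    show "e \<in> up \<union> up\<inverse>"
    proof (rule ccontr)
      assume not: "e \<notin> up \<union> up\<inverse>"
      have "u \<in> pverts B" "v \<in> pverts B" using e uv B.in_arcsD1 B.in_arcsD2 by blast+
      \<comment> \<open>The edges to parents lead from \<open>u\<close> up to the root and down to \<open>v\<close>.\<close>
      then have "(u, r) \<in> up\<^sup>*" "(r, v) \<in> (up\<inverse>)\<^sup>*" using up_root by (auto simp: rtrancl_converse)
      moreover have "up \<subseteq> ?R - {(u, v), (v, u)}" "up\<inverse> \<subseteq> ?R - {(u, v), (v, u)}"
        using not sub uv by auto
      ultimately have "(u, v) \<in> (?R - {(u, v), (v, u)})\<^sup>*"
        by (meson rtrancl_mono rtrancl_trans subsetD)
      then show False using undirected_tree_arc_is_bridge[OF T] e uv by blast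
    qed
  qed
  then show thesis using that sub rooted_tree_axioms by blast
qed

text \<open>
  Every arc of the star has exactly one end at the center, so a walk of three arcs is at the center
  at its second and fourth vertex or at its first and third. Either repetition is impossible in a
  cycle of length at least three.
\<close>

lemma undirected_tree_star_graph:
  assumes "finite S" "z \<in> S"
  shows "undirected_tree (star_graph S z)"
proof -
  interpret pair_graph "star_graph S z"
    by unfold_locales
      (use assms in \<open>auto simp: star_graph_def symmetric_def sym_def\<close>)
  have zadj: "(z, u) \<in> (parcs (star_graph S z))\<^sup>*" "(u, z) \<in> (parcs (star_graph S z))\<^sup>*" if "u \<in> S" for u
    using that by (cases "u = z"; auto simp: star_graph_def)+
  have conn: "Digraph_Component.connected (with_proj (star_graph S z))"
  proof (rule connectedI)
    fix u v assume "u \<in> pverts (star_graph S z)" "v \<in> pverts (star_graph S z)"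
    then have uv: "u \<in> pverts (star_graph S z)" "u \<in> S" "v \<in> S" by (auto simp: star_graph_def)
    then have "u \<rightarrow>\<^sup>*\<^bsub>with_proj (star_graph S z)\<^esub> v"
      using zadj[of u] zadj[of v] by (simp add: reachable_conv')
    then show "u \<rightarrow>\<^sup>*\<^bsub>with_proj (mk_symmetric (with_proj (star_graph S z)))\<^esub> v"
      by (rule reachable_mk_symmetricI)
  qed (use assms in \<open>auto simp: star_graph_def\<close>)
  have "\<not> (cycle p \<and> 3 \<le> length p)" for p
  proof
    assume p: "cycle p \<and> 3 \<le> length p"
    then obtain e1 e2 e3 q where pq: "p = e1 # e2 # e3 # q"
      by (auto simp: Suc_le_length_iff numeral_3_eq_3)
    obtain a where w: "awalk a p a" and d: "distinct (tl (pawalk_verts a p))"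
      using p by (auto simp: cycle_def)
    obtain b c d where e: "e1 = (a, b)" "e2 = (b, c)" "e3 = (c, d)" and w': "awalk d q a"
      using w unfolding pq by (cases e1; cases e2; cases e3) (auto simp: awalk_Cons_iff)
    have arcs: "(a, b) \<in> parcs (star_graph S z)" "(b, c) \<in> parcs (star_graph S z)"
      "(c, d) \<in> parcs (star_graph S z)"
      using w unfolding pq e by (auto simp: awalk_Cons_iff)
    have dist: "distinct (b # c # pawalk_verts d q)" using d unfolding pq e by simp
    have "a \<in> set (pawalk_verts d q)" "d \<in> set (pawalk_verts d q)"
      using awhd_of_awalk[OF w'] awlast_of_awalk[OF w'] awalk_verts_non_Nil[of d q]
        hd_in_set[of "pawalk_verts d q"] last_in_set[of "pawalk_verts d q"]
      by (simp_all add: NOMATCH_def)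
    then have "b \<noteq> d" "c \<noteq> a" using dist by auto
    then show False using arcs by (auto simp: star_graph_def)
  qed
  then show ?thesis using conn pair_graph by (auto simp: undirected_tree_def)
qed

lemma rooted_tree_star:
  assumes "z \<in> S"
  shows "rooted_tree S z (\<lambda>_. z) (\<lambda>k. of_bool (k \<noteq> z))"
  using assms by unfold_locales auto

lemma parcs_star_graph:
  assumes "z \<in> S"
  shows "parcs (star_graph S z) = rooted_tree.up S z (\<lambda>_. z) \<union> (rooted_tree.up S z (\<lambda>_. z))\<inverse>"
  by (auto simp: star_graph_def rooted_tree.up_def[OF rooted_tree_star[OF assms]])

lemma subtree_star:
  assumes "z \<in> S" "k \<in> S - {z}"
  shows "rooted_tree.subtree S z (\<lambda>_. z) k = {k}"
proof -
  interpret rooted_tree S z "\<lambda>_. z" "\<lambda>k. of_bool (k \<noteq> z)"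
    using assms(1) by (rule rooted_tree_star)
  have "j = k" if "j \<in> subtree k" for j
    using subtree_depth[OF that] assms(2) by (auto simp: of_bool_def split: if_splits)
  then show ?thesis using subtree_self by blast
qed

section \<open>Coherence of composite graphs\<close>

text \<open>
  The parts of a composite graph without the backbone. The map \<open>\<rho>\<close> sends a node to the bridge node of
  its part, so the parts are the fibres of \<open>\<rho>\<close> and the bridge nodes are the set \<open>\<rho> ` V\<close>. The set \<open>E\<close>
  consists of the arcs of all parts.
\<close>

locale bridged_parts =
  fixes V :: "'v::finite set" and \<rho> :: "'v \<Rightarrow> 'v" and E :: "'v rel"
  assumes arcs_in: "E \<subseteq> V \<times> V" and sym_E: "sym E" and irrefl_E: "irrefl E"
    and bridge_in: "v \<in> V \<Longrightarrow> \<rho> v \<in> V" and bridge_bridge: "v \<in> V \<Longrightarrow> \<rho> (\<rho> v) = \<rho> v"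
    and arc_same_part: "(u, w) \<in> E \<Longrightarrow> \<rho> u = \<rho> w"
    and reach_bridge: "v \<in> V \<Longrightarrow> (v, \<rho> v) \<in> E\<^sup>*"
begin

text \<open>
  The current that enters at \<open>v\<close> leaves within the same part, so it is orthogonal to the kernel, which
  consists of functions that are constant on every part. Such a function can be subtracted from a
  solution to make it zero at every bridge node. The backbone then does not see the potential.
\<close>

lemma grounded_potential_exists:
  assumes "v \<in> V"
  shows "\<exists>y. arc_laplacian E y = axis v 1 - axis (\<rho> v) 1 \<and> (\<forall>s\<in>\<rho> ` V. y $ s = 0)"
proof -
  have "axis v 1 - axis (\<rho> v) 1 \<in> range (arc_laplacian E)"
  proof (rule range_self_adjoint[OF linear_arc_laplacian arc_laplacian_self_adjoint[OF sym_E]])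
    fix x assume "arc_laplacian E x = 0"
    then show "x \<bullet> (axis v 1 - axis (\<rho> v) 1) = 0"
      using arc_laplacian_eq_0D[OF sym_E _ reach_bridge[OF assms]] by (simp add: inner_diff_right inner_axis)
  qed
  then obtain y where y: "arc_laplacian E y = axis v 1 - axis (\<rho> v) 1" by (metis imageE)
  define z where "z = (\<chi> u. y $ \<rho> u)"
  have "arc_laplacian E z = 0" by (rule arc_laplacian_eq_0) (simp add: z_def arc_same_part)
  then have "arc_laplacian E (y - z) = axis v 1 - axis (\<rho> v) 1" by (simp add: linear_diff[OF linear_arc_laplacian] y)
  moreover have "\<forall>s\<in>\<rho> ` V. (y - z) $ s = 0" by (simp add: z_def bridge_bridge)
  ultimately show ?thesis by blast
qed

definition potential :: "'v \<Rightarrow> real^'v" where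
  "potential v = (SOME y. arc_laplacian E y = axis v 1 - axis (\<rho> v) 1 \<and> (\<forall>s\<in>\<rho> ` V. y $ s = 0))"

lemma potential:
  assumes "v \<in> V"
  shows "arc_laplacian E (potential v) = axis v 1 - axis (\<rho> v) 1"
    and "s \<in> \<rho> ` V \<Longrightarrow> potential v $ s = 0"
  using someI_ex[OF grounded_potential_exists[OF assms]] by (auto simp: potential_def)

text \<open>
  The contribution of the parts to twice the coherence. It is the same for every
  backbone, so it cancels when two backbones are compared.
\<close>

definition parts_cost :: real where
  "parts_cost = (\<Sum>v\<in>V. potential v $ v - (\<Sum>w\<in>V. potential v $ w) / card V)"

definition weight :: "'v set \<Rightarrow> real" where
  "weight A = card {v \<in> V. \<rho> v \<in> A}"

text \<open>
  To send a unit current from \<open>v\<close> to the root \<open>r\<close>, send it from \<open>v\<close> to the bridge node \<open>\<rho> v\<close> by the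
  potential of the part, and from there up the tree edge by edge. For the edge above \<open>k\<close>, the
  indicator of all parts below \<open>k\<close> is the potential: it is constant on every part, so no current
  flows inside the parts. The indicators make up the terms that depend on the backbone.
\<close>

lemma coherence_rooted_tree:
  assumes tree: "rooted_tree (\<rho> ` V) r par depth"
    and H: "parcs H = E \<union> (rooted_tree.up (\<rho> ` V) r par \<union> (rooted_tree.up (\<rho> ` V) r par)\<inverse>)"
  shows "coherence H = (parts_cost + (\<Sum>k\<in>\<rho> ` V - {r}.
    weight (rooted_tree.subtree (\<rho> ` V) r par k) * (card V - weight (rooted_tree.subtree (\<rho> ` V) r par k))
      / card V)) / 2"
proof -
  interpret rooted_tree "\<rho> ` V" r par depth by fact
  let ?S = "\<rho> ` V" and ?T = "up \<union> up\<inverse>"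
  have S: "s \<in> V" "\<rho> s = s" if "s \<in> ?S" for s using that bridge_in bridge_bridge by auto
  have T: "?T \<subseteq> ?S \<times> ?S" using par_in by (auto simp: up_def)
  have disj: "E \<inter> ?T = {}"
  proof -
    have False if "(a, b) \<in> E" "(a, b) \<in> ?T" for a b
    proof -
      have "a = b" using that T arc_same_part[of a b] S[of a] S[of b] by auto
      then show False using that irrefl_E by (auto simp: irrefl_def)
    qed
    then show ?thesis by auto
  qed
  have arcs: "parcs H \<subseteq> V \<times> V" "sym (parcs H)" "irrefl (parcs H)"
  proof -
    show "parcs H \<subseteq> V \<times> V" unfolding H using arcs_in T S by blast
    show "sym (parcs H)" unfolding H using sym_E by (auto simp: sym_def)
    show "irrefl (parcs H)" unfolding H using irrefl_E par_neq by (force simp: irrefl_def up_def)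
  qed
  define below :: "'v \<Rightarrow> real^'v" where "below k = (\<chi> u. of_bool (u \<in> V \<and> \<rho> u \<in> subtree k))" for k
  define x where "x v = potential v + (\<Sum>k\<in>?S - {r}. of_bool (\<rho> v \<in> subtree k) *\<^sub>R below k)" for v
  have laplacian_below: "arc_laplacian (parcs H) (below k) = axis k 1 - axis (par k) 1" if "k \<in> ?S - {r}" for k
  proof -
    have "arc_laplacian E (below k) = 0" 
    proof (rule arc_laplacian_eq_0)
      fix u w assume "(u, w) \<in> E"
      then show "below k $ u = below k $ w" using arcs_in arc_same_part[of u w] by (auto simp: below_def)
    qed
    moreover have "arc_laplacian ?T (below k) = axis k 1 - axis (par k) 1"
    proof (rule arc_laplacian_indicator_subtree[OF tree that])
      fix u assume "u \<in> ?S"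
      then show "below k $ u = of_bool (u \<in> subtree k)" using S[of u] by (simp add: below_def)
    qed
    ultimately show ?thesis unfolding H arc_laplacian_Un[OF disj] by simp
  qed
  have "arc_laplacian (parcs H) (x v) = axis v 1 - axis r 1" if v: "v \<in> V" for v
  proof -
    have "arc_laplacian ?T (potential v) = 0"
      using T potential(2)[OF v] by (intro arc_laplacian_eq_0) (metis SigmaE2 subsetD)
    then have p: "arc_laplacian (parcs H) (potential v) = axis v 1 - axis (\<rho> v) 1"
      unfolding H arc_laplacian_Un[OF disj] by (simp add: potential(1)[OF v])
    have "arc_laplacian (parcs H) (\<Sum>k\<in>?S - {r}. of_bool (\<rho> v \<in> subtree k) *\<^sub>R below k)
        = (\<Sum>k\<in>?S - {r}. if \<rho> v \<in> subtree k then axis k 1 - axis (par k) 1 else 0)"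
      unfolding linear_sum[OF linear_arc_laplacian]
      by (intro sum.cong) (auto simp: linear_cmul[OF linear_arc_laplacian] laplacian_below linear_0[OF linear_arc_laplacian])
    also have "\<dots> = (\<Sum>k | k \<in> ?S - {r} \<and> \<rho> v \<in> subtree k. axis k 1 - axis (par k) 1)"
      by (subst sum.inter_filter[symmetric]) auto
    also have "\<dots> = axis (\<rho> v) 1 - axis r 1"
      using v by (intro sum_edges_to_root) auto
    finally show ?thesis by (simp add: x_def linear_add[OF linear_arc_laplacian] p)
  qed
  then have "coherence H = (\<Sum>v\<in>V. x v $ v - (\<Sum>w\<in>V. x v $ w) / card V) / 2"
    by (rule coherence_of_grounded_potentials[OF arcs])
  also have "(\<Sum>v\<in>V. x v $ v - (\<Sum>w\<in>V. x v $ w) / card V) = parts_cost +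
      (\<Sum>k\<in>?S - {r}. weight (subtree k) * (card V - weight (subtree k)) / card V)"
  proof -
    have w: "(\<Sum>w\<in>V. below k $ w) = weight (subtree k)" for k
      by (simp add: below_def weight_def of_bool_def sum.If_cases Int_def)
    have w': "(\<Sum>v\<in>V. of_bool (\<rho> v \<in> subtree k)) = weight (subtree k)" for k
      by (simp add: weight_def of_bool_def sum.If_cases Int_def)
    have "x v $ v - (\<Sum>w\<in>V. x v $ w) / card V =
        (potential v $ v - (\<Sum>w\<in>V. potential v $ w) / card V) +
        (\<Sum>k\<in>?S - {r}. of_bool (\<rho> v \<in> subtree k) * (1 - weight (subtree k) / card V))"
      if "v \<in> V" for v
    proof -
      have "x v $ v = potential v $ v + (\<Sum>k\<in>?S - {r}. of_bool (\<rho> v \<in> subtree k))"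
        using that by (simp add: x_def below_def of_bool_conj[symmetric])
      moreover have "(\<Sum>w\<in>V. x v $ w) = (\<Sum>w\<in>V. potential v $ w) +
          (\<Sum>k\<in>?S - {r}. of_bool (\<rho> v \<in> subtree k) * weight (subtree k))"
      proof -
        have "(\<Sum>w\<in>V. x v $ w) = (\<Sum>w\<in>V. potential v $ w) +
            (\<Sum>w\<in>V. \<Sum>k\<in>?S - {r}. of_bool (\<rho> v \<in> subtree k) * below k $ w)"
          by (simp add: x_def sum.distrib del: sum_of_bool_mult_eq)
        also have "(\<Sum>w\<in>V. \<Sum>k\<in>?S - {r}. of_bool (\<rho> v \<in> subtree k) * below k $ w) =
            (\<Sum>k\<in>?S - {r}. \<Sum>w\<in>V. of_bool (\<rho> v \<in> subtree k) * below k $ w)"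
          by (rule sum.swap)
        also have "\<dots> = (\<Sum>k\<in>?S - {r}. of_bool (\<rho> v \<in> subtree k) * weight (subtree k))"
          by (simp add: w sum_distrib_left[symmetric])
        finally show ?thesis .
      qed
      ultimately show ?thesis
        by (simp add: right_diff_distrib add_divide_distrib sum_subtractf sum_divide_distrib
            del: sum_of_bool_eq sum_of_bool_mult_eq sum_mult_of_bool_eq)
    qed
    then have "(\<Sum>v\<in>V. x v $ v - (\<Sum>w\<in>V. x v $ w) / card V) = parts_cost +
        (\<Sum>v\<in>V. \<Sum>k\<in>?S - {r}. of_bool (\<rho> v \<in> subtree k) * (1 - weight (subtree k) / card V))"
      by (simp add: parts_cost_def sum.distrib
          del: sum_of_bool_eq sum_of_bool_mult_eq sum_mult_of_bool_eq)
    also have "(\<Sum>v\<in>V. \<Sum>k\<in>?S - {r}. of_bool (\<rho> v \<in> subtree k) * (1 - weight (subtree k) / card V)) =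
        (\<Sum>k\<in>?S - {r}. \<Sum>v\<in>V. of_bool (\<rho> v \<in> subtree k) * (1 - weight (subtree k) / card V))"
      by (rule sum.swap)
    also have "\<dots> = (\<Sum>k\<in>?S - {r}. weight (subtree k) * (1 - weight (subtree k) / card V))"
      by (simp only: sum_distrib_right[symmetric] w')
    also have "\<dots> = (\<Sum>k\<in>?S - {r}. weight (subtree k) * (card V - weight (subtree k)) / card V)"
    proof -
      have "card V \<noteq> 0" using S(1)[OF root_in] by auto
      then show ?thesis by (simp add: field_simps)
    qed
    finally show ?thesis .
  qed
  finally show ?thesis .
qed

text \<open>
  The comparison holds term by term. With \<open>m\<close> the size of the part of \<open>k\<close>, \<open>s\<close> the size below \<open>k\<close>, and \<open>N\<close> the
  total size, the difference \<open>s * (N - s) - m * (N - m)\<close> factors as \<open>(s - m) * (N - s - m)\<close>. The second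
  factor is nonnegative because the largest part lies outside the subtree of \<open>k\<close>.
\<close>

lemma star_coherence_le:
  assumes tree: "rooted_tree (\<rho> ` V) r par depth"
    and H: "parcs H = E \<union> (rooted_tree.up (\<rho> ` V) r par \<union> (rooted_tree.up (\<rho> ` V) r par)\<inverse>)"
    and star: "parcs H' = E \<union> parcs (star_graph (\<rho> ` V) r)"
    and max: "\<And>k. k \<in> \<rho> ` V \<Longrightarrow> weight {k} \<le> weight {r}"
  shows "coherence H' \<le> coherence H"
proof -
  interpret rooted_tree "\<rho> ` V" r par depth by fact
  have "weight {k} * (card V - weight {k}) \<le> weight (subtree k) * (card V - weight (subtree k))"
    if k: "k \<in> \<rho> ` V - {r}" for k
  proof -
    have "weight {k} \<le> weight (subtree k)"
      unfolding weight_def of_nat_le_iff using subtree_self by (intro card_mono) auto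
    moreover have "weight (subtree k) + weight {r} \<le> card V"
    proof -
      have "{v \<in> V. \<rho> v \<in> subtree k} \<inter> {v \<in> V. \<rho> v \<in> {r}} = {}"
        using root_in_subtree k by auto
      then have "card {v \<in> V. \<rho> v \<in> subtree k} + card {v \<in> V. \<rho> v \<in> {r}} =
          card ({v \<in> V. \<rho> v \<in> subtree k} \<union> {v \<in> V. \<rho> v \<in> {r}})"
        by (simp add: card_Un_disjoint)
      also have "\<dots> \<le> card V" by (intro card_mono) auto
      finally show ?thesis by (simp add: weight_def)
    qed
    ultimately have "0 \<le> (weight (subtree k) - weight {k}) * (card V - weight (subtree k) - weight {k})"
      using max[of k] k by (intro mult_nonneg_nonneg) auto
    then show ?thesis by (simp add: algebra_simps)
  qed
  then have "(\<Sum>k\<in>\<rho> ` V - {r}. weight {k} * (card V - weight {k}) / card V) \<le>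
      (\<Sum>k\<in>\<rho> ` V - {r}. weight (subtree k) * (card V - weight (subtree k)) / card V)"
    by (intro sum_mono divide_right_mono) auto
  moreover have "coherence H' =
      (parts_cost + (\<Sum>k\<in>\<rho> ` V - {r}. weight {k} * (card V - weight {k}) / card V)) / 2"
    using coherence_rooted_tree[OF rooted_tree_star[OF root_in], of H']
    by (simp add: star parcs_star_graph[OF root_in] subtree_star[OF root_in])
  ultimately show ?thesis using coherence_rooted_tree[OF tree H] by simp
qed

end

theorem corollary1:
  fixes n c :: nat
    and G :: "nat \<Rightarrow> 'v::finite pair_pre_digraph"
    and l :: "nat \<Rightarrow> 'v"
  assumes graphs: "\<And>i. i \<in> {1..n} \<Longrightarrow> pair_graph (G i)"
    and conn: "\<And>i. i \<in> {1..n} \<Longrightarrow> Digraph_Component.connected (with_proj (G i))"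
    and disj: "disjoint_family_on (\<lambda>i. pverts (G i)) {1..n}"
    and bridge: "\<And>i. i \<in> {1..n} \<Longrightarrow> l i \<in> pverts (G i)"
    and center: "is_arg_max (\<lambda>i. card (pverts (G i))) (\<lambda>i. i \<in> {1..n}) c"
  shows "is_arg_min coherence
           (\<lambda>H. \<exists>B. undirected_tree B \<and> pverts B = l ` {1..n} \<and> H = composite_graph n G B)
           (composite_graph n G (star_graph (l ` {1..n}) (l c)))"
proof -
  have c: "c \<in> {1..n}" and cmax: "\<And>i. i \<in> {1..n} \<Longrightarrow> card (pverts (G i)) \<le> card (pverts (G c))"
    using center by (auto simp: is_arg_max_def not_less)
  define V where "V = (\<Union>i\<in>{1..n}. pverts (G i))"
  define E where "E = (\<Union>i\<in>{1..n}. parcs (G i))"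
  define \<rho> where "\<rho> v = l (THE i. i \<in> {1..n} \<and> v \<in> pverts (G i))" for v
  have \<rho>: "\<rho> v = l i" if "i \<in> {1..n}" "v \<in> pverts (G i)" for i v
  proof -
    have "(THE j. j \<in> {1..n} \<and> v \<in> pverts (G j)) = i"
      using that disjoint_family_onD[OF disj] by (intro the_equality) blast+
    then show ?thesis by (simp add: \<rho>_def)
  qed
  have l: "l i \<in> V" "\<rho> (l i) = l i" if "i \<in> {1..n}" for i
    using bridge[OF that] \<rho>[OF that] that unfolding V_def by blast+
  have E: "u \<in> V" "w \<in> V" "(w, u) \<in> E" "u \<noteq> w" "\<rho> u = \<rho> w" if "(u, w) \<in> E" for u w
  proof -
    from that obtain i where i: "i \<in> {1..n}" "(u, w) \<in> parcs (G i)" unfolding E_def by blast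
    interpret pair_graph "G i" using graphs[OF i(1)] .
    have "u \<in> pverts (G i)" "w \<in> pverts (G i)" "(w, u) \<in> parcs (G i)" "u \<noteq> w"
      using i(2) in_arcsD1 in_arcsD2 arcs_symmetric no_loops' by auto
    then show "u \<in> V" "w \<in> V" "(w, u) \<in> E" "u \<noteq> w" "\<rho> u = \<rho> w"
      using i \<rho>[OF i(1)] unfolding V_def E_def by auto
  qed
  interpret bridged_parts V \<rho> E
  proof
    show "E \<subseteq> V \<times> V" using E(1,2) by auto
    show "sym E" using E(3) by (rule symI)
    show "irrefl E" using E(4) by (auto intro: irreflI)
    show "\<rho> u = \<rho> w" if "(u, w) \<in> E" for u w
      using that by (rule E(5))
  next
    fix v assume "v \<in> V"
    then obtain i where i: "i \<in> {1..n}" "v \<in> pverts (G i)" unfolding V_def by blast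
    show "\<rho> v \<in> V" "\<rho> (\<rho> v) = \<rho> v" using l[OF i(1)] \<rho>[OF i] by simp_all
    have "(v, \<rho> v) \<in> (parcs (G i))\<^sup>*"
      using connected_rtrancl[OF graphs conn] i bridge \<rho> by simp
    moreover have "parcs (G i) \<subseteq> E" using i by (auto simp: E_def)
    ultimately show "(v, \<rho> v) \<in> E\<^sup>*" using rtrancl_mono by blast
  qed
  have S: "\<rho> ` V = l ` {1..n}"
  proof
    show "\<rho> ` V \<subseteq> l ` {1..n}" using \<rho> unfolding V_def by blast
    show "l ` {1..n} \<subseteq> \<rho> ` V" using l by (metis image_eqI image_subsetI)
  qed
  \<comment> \<open>Distinct parts have distinct bridge nodes because the parts are disjoint.\<close>
  have inj: "i = j" if "i \<in> {1..n}" "j \<in> {1..n}" "l i = l j" for i j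
    using that bridge[of i] bridge[of j] disjoint_family_onD[OF disj, of i j] by force
  have wt: "weight {l i} = card (pverts (G i))" if "i \<in> {1..n}" for i
  proof -
    have "{v \<in> V. \<rho> v \<in> {l i}} = pverts (G i)"
    proof
      show "{v \<in> V. \<rho> v \<in> {l i}} \<subseteq> pverts (G i)"
      proof
        fix v assume v: "v \<in> {v \<in> V. \<rho> v \<in> {l i}}"
        then obtain j where j: "j \<in> {1..n}" "v \<in> pverts (G j)" unfolding V_def by blast
        then have "l j = l i" using v \<rho>[OF j] by simp
        then show "v \<in> pverts (G i)" using inj[OF j(1) that] j(2) by simp
      qed
      show "pverts (G i) \<subseteq> {v \<in> V. \<rho> v \<in> {l i}}"
        using that \<rho>[OF that] unfolding V_def by blast
    qed
    then show ?thesis by (simp add: weight_def)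
  qed
  have star_le: "coherence (composite_graph n G (star_graph (l ` {1..n}) (l c)))
      \<le> coherence (composite_graph n G B)"
    if B: "undirected_tree B" "pverts B = l ` {1..n}" for B
  proof -
    have "l c \<in> pverts B" using B c by simp
    then obtain par depth where t: "rooted_tree (\<rho> ` V) (l c) par depth"
      "parcs B = rooted_tree.up (\<rho> ` V) (l c) par \<union> (rooted_tree.up (\<rho> ` V) (l c) par)\<inverse>"
      using undirected_tree_rooted[OF B(1)] unfolding B(2) S by metis
    show ?thesis
    proof (rule star_coherence_le[OF t(1)])
      show "weight {k} \<le> weight {l c}" if "k \<in> \<rho> ` V" for k
      proof -
        obtain i where "i \<in> {1..n}" "k = l i" using \<open>k \<in> \<rho> ` V\<close> unfolding S by blast
        then show ?thesis using wt cmax c by simp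
      qed
    qed (simp_all add: composite_graph_def E_def S t(2))
  qed
  have "undirected_tree (star_graph (l ` {1..n}) (l c))"
    using c by (intro undirected_tree_star_graph) auto
  moreover have "pverts (star_graph (l ` {1..n}) (l c)) = l ` {1..n}" by (simp add: star_graph_def)
  ultimately show ?thesis
    unfolding is_arg_min_def using star_le by (auto simp: not_less)
qed

end
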